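(* Let $\mathbb{H}$ be a real separable Hilbert space with unit sphere $\mathbb{S}$, let $X\sim P_X$ be a random element of $\mathbb{H}$ such that $P_X$ has no atoms, let $u\in(0,1)$, and let $V\sim\nu$ be a random element supported on $\mathbb{S}$, which is smooth in the sense that $\nu(H\cap\mathbb{S})=0$ for every hyperplane $H\subset\mathbb{H}$ through the origin. For $v\in\mathbb{S}$ let $F_v$ be the distribution function of $\langle X,v\rangle$ and $\omega_v(\delta)=\sup_{|t_1-t_2|\le\delta}|F_v(t_1)-F_v(t_2)|$, $\delta\ge0$. For $\varepsilon\in(0,1/2)$ consider the condition $$(\ast)_\varepsilon\qquad \exists\,\gamma>0:\quad \nu\left(\left\{v\in\mathbb{S}:\omega_v(\gamma)<\frac{1/2-\varepsilon}{1-\varepsilon}\right\}\right)\ge1-u.$$ If $(\ast)_\varepsilon$ holds for some $\varepsilon\in(0,1/2)$, then, for that $\varepsilon$, $$\sup_{Q\in\mathcal{P}(\mathbb{H})}\ \sup_{v\in\mathcal{V}_{(u)}(Q,\varepsilon)}\big|\langle\theta(P_{(Q,\varepsilon)})-\theta(P_X),v\rangle\big|<\infty.$$ Consequently, if $(\ast)_\varepsilon$ holds for every $\varepsilon\in(0,1/2)$, then $\varepsilon^*_{(u)}(\theta;P_X)=1/2$.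
   Context: $\mathbb{H}$ has inner product $\langle\cdot,\cdot\rangle$ and induced norm $\|\cdot\|$; $\mathbb{S}=\{v\in\mathbb{H}:\|v\|=1\}$; $\mathcal{P}(\mathbb{H})$ is the set of Borel probability measures on $\mathbb{H}$. A hyperplane is a set $\{x\in\mathbb{H}:\langle x,v\rangle=c\}$ with $v\in\mathbb{S}$, $c\in\mathbb{R}$. The support of $V$ is the smallest closed set $A\subseteq\mathbb{H}$ with $\mathbb{P}(V\in A)=1$; "supported on $\mathbb{S}$" means this set is $\mathbb{S}$. $V$ is independent of all other random elements. For a real random variable $U$, $\mathsf{med}[U]$ is the midpoint of the set of all $m\in\mathbb{R}$ with $\min\{\mathbb{P}(U\le m),\mathbb{P}(U\ge m)\}\ge1/2$, and $\mathsf{MAD}[U]=\mathsf{med}[|U-\mathsf{med}[U]|]$. For a non-negative random variable $Z$ with distribution function $F$, its $u$-quantile is $q_u[Z]=\inf\{x\ge0:F(x)\ge u\}$. For a random element $Y\sim P_Y$ of $\mathbb{H}$, $\mathsf{MAD}[\langle Y,V\rangle]$ is viewed as the random variable $\omega\mapsto\mathsf{MAD}[\langle Y,V(\omega)\rangle]$, random through $V$ only. Let $\beta(u)=q_u[\mathsf{MAD}[\langle Y,V\rangle]]$, $\mathcal{V}_{(u)}=\mathcal{V}_{(u)}(P_Y)=\{v\in\mathbb{S}:\mathsf{MAD}[\langle Y,v\rangle]\ge\beta(u)\}$, $$O_v(x;P_Y)=\frac{|\langle x,v\rangle-\mathsf{med}[\langle Y,v\rangle]|}{\mathsf{MAD}[\langle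 Y,v\rangle]},\qquad D_{(u)}(x;P_Y)=\inf_{v\in\mathcal{V}_{(u)}(P_Y)}(1+O_v(x;P_Y))^{-1}.$$ The depth median $\theta(P_Y)$ is any maximizer of $\theta\mapsto D_{(u)}(\theta;P_Y)$ over the closed linear span of $\mathcal{V}_{(u)}(P_Y)$. The particular choice of the representatives $\theta(P_X)$ and $\theta(P_{(Q,\varepsilon)})$ among the maximizers is immaterial. Contamination: for $\varepsilon\in[0,1]$ and $Q\in\mathcal{P}(\mathbb{H})$ let $P_{(Q,\varepsilon)}=(1-\varepsilon)P_X+\varepsilon Q$. With $X'\sim P_{(Q,\varepsilon)}$, let $\beta_{(Q,\varepsilon)}(u)$ be the $u$-quantile of $\mathsf{MAD}[\langle X',V\rangle]$ and $$\mathcal{V}_{(u)}(Q,\varepsilon)=\{v\in\mathbb{S}:\mathsf{MAD}[\langle X',v\rangle]\ge\beta_{(Q,\varepsilon)}(u)\}$$ (i.e. $\mathcal{V}_{(u)}(Q,\varepsilon)=\mathcal{V}_{(u)}(P_{(Q,\varepsilon)})$). The breakdown point is $$\varepsilon^*_{(u)}(\theta;P_X)=\inf\Big\{\varepsilon\in[0,1]:\ \sup_{Q\in\mathcal{P}(\mathbb{H})}\ \sup_{v\in\mathcal{V}_{(u)}(Q,\varepsilon)}\big|\langle\theta(P_{(Q,\varepsilon)})-\theta(P_X),v\rangle\big|=\infty\Big\}.$$ *)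

theory Defs
  imports "HOL-Probability.Probability"
begin

text \<open>
  The underlying space is a type of class \<open>{real_inner, polish_space}\<close>, i.e. a real separable
  Hilbert space. Random elements are represented by their laws: Borel probability measures,
  the elements of \<open>space (prob_algebra borel)\<close>.
\<close>

definition med :: "'b measure \<Rightarrow> ('b \<Rightarrow> real) \<Rightarrow> real" where
  "med M U =
    (let A = {m. min (\<P>(x in M. U x \<le> m)) (\<P>(x in M. U x \<ge> m)) \<ge> 1/2}
     in (Inf A + Sup A) / 2)"

definition MAD :: "'b measure \<Rightarrow> ('b \<Rightarrow> real) \<Rightarrow> real" where
  "MAD M U = med M (\<lambda>x. \<bar>U x - med M U\<bar>)"

definition quantile :: "real \<Rightarrow> 'b measure \<Rightarrow> ('b \<Rightarrow> real) \<Rightarrow> real" where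
  "quantile u M Z = Inf {x. x \<ge> 0 \<and> \<P>(y in M. Z y \<le> x) \<ge> u}"

definition hyperplane :: "'a::real_inner set \<Rightarrow> bool" where
  "hyperplane H \<longleftrightarrow> (\<exists>v\<in>sphere 0 1. \<exists>c. H = {x. inner x v = c})"

definition has_support :: "'a::topological_space measure \<Rightarrow> 'a set \<Rightarrow> bool" where
  "has_support M A \<longleftrightarrow> closed A \<and> measure M A = 1 \<and>
     (\<forall>B. closed B \<and> measure M B = 1 \<longrightarrow> A \<subseteq> B)"

text \<open>Below, \<open>\<nu>\<close> is the law of \<open>V\<close>, so functions of \<open>V\<close> are random variables on \<open>\<nu>\<close>.\<close>

definition beta :: "'a::real_inner measure \<Rightarrow> real \<Rightarrow> 'a measure \<Rightarrow> real" where
  "beta \<nu> u P = quantile u \<nu> (\<lambda>v. MAD P (\<lambda>y. inner y v))"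

definition directions :: "'a::real_inner measure \<Rightarrow> real \<Rightarrow> 'a measure \<Rightarrow> 'a set" where
  "directions \<nu> u P = {v \<in> sphere 0 1. MAD P (\<lambda>y. inner y v) \<ge> beta \<nu> u P}"

text \<open>
  Outlyingness takes values in \<open>[0, \<infinity>]\<close>. If the MAD vanishes (which can happen when the
  contamination level is at least one half), division in \<open>ennreal\<close> gives \<open>a / 0 = \<infinity>\<close> for
  \<open>a > 0\<close> and \<open>0 / 0 = 0\<close>; real division would instead give outlyingness 0 everywhere.
\<close>

definition outlyingness :: "'a::real_inner measure \<Rightarrow> 'a \<Rightarrow> 'a \<Rightarrow> ennreal" where
  "outlyingness P v x =
     ennreal \<bar>inner x v - med P (\<lambda>y. inner y v)\<bar> / ennreal (MAD P (\<lambda>y. inner y v))"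

definition depth :: "'a::real_inner measure \<Rightarrow> real \<Rightarrow> 'a measure \<Rightarrow> 'a \<Rightarrow> ennreal" where
  "depth \<nu> u P x = (INF v\<in>directions \<nu> u P. inverse (1 + outlyingness P v x))"

definition is_depth_median :: "'a::real_inner measure \<Rightarrow> real \<Rightarrow> 'a measure \<Rightarrow> 'a \<Rightarrow> bool" where
  "is_depth_median \<nu> u P = is_arg_max (depth \<nu> u P) (\<lambda>x. x \<in> closure (span (directions \<nu> u P)))"

text \<open>
  \<open>\<theta>\<close> is an arbitrary choice of a maximizer for every law that has one. That every Borel law has
  a maximizer is not assumed.
\<close>

definition depth_median_choice ::
  "'a::real_inner measure \<Rightarrow> real \<Rightarrow> ('a measure \<Rightarrow> 'a) \<Rightarrow> bool" where
  "depth_median_choice \<nu> u \<theta> \<longleftrightarrow>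
     (\<forall>P \<in> space (prob_algebra borel).
        (\<exists>t. is_depth_median \<nu> u P t) \<longrightarrow> is_depth_median \<nu> u P (\<theta> P))"

definition contaminate :: "real \<Rightarrow> 'a::topological_space measure \<Rightarrow> 'a measure \<Rightarrow> 'a measure" where
  "contaminate \<epsilon> P Q = measure_of UNIV (sets borel)
     (\<lambda>A. ennreal (1 - \<epsilon>) * emeasure P A + ennreal \<epsilon> * emeasure Q A)"

lemma sets_contaminate [simp]: "sets (contaminate \<epsilon> P Q) = sets borel"
  unfolding contaminate_def
  by (metis sets.sigma_sets_eq sets_measure_of space_borel top_greatest Pow_UNIV)

lemma space_contaminate [simp]: "space (contaminate \<epsilon> P Q) = UNIV"
  unfolding contaminate_def by (simp add: space_measure_of_conv)

lemma emeasure_contaminate: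
  assumes P: "sets P = sets borel" and Q: "sets Q = sets borel" and A: "A \<in> sets borel"
  shows "emeasure (contaminate \<epsilon> P Q) A =
    ennreal (1 - \<epsilon>) * emeasure P A + ennreal \<epsilon> * emeasure Q A"
proof (rule emeasure_measure_of[OF contaminate_def])
  show "countably_additive (sets (contaminate \<epsilon> P Q))
     (\<lambda>A. ennreal (1 - \<epsilon>) * emeasure P A + ennreal \<epsilon> * emeasure Q A)"
  proof (rule countably_additiveI)
    fix F :: "nat \<Rightarrow> 'a set"
    assume F: "range F \<subseteq> sets (contaminate \<epsilon> P Q)" "disjoint_family F"
    have "(\<Sum>i. emeasure P (F i)) = emeasure P (\<Union>i. F i)"
      and "(\<Sum>i. emeasure Q (F i)) = emeasure Q (\<Union>i. F i)"
      using F P Q by (simp_all add: suminf_emeasure)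
    then show "(\<Sum>i. ennreal (1 - \<epsilon>) * emeasure P (F i) + ennreal \<epsilon> * emeasure Q (F i)) =
        ennreal (1 - \<epsilon>) * emeasure P (\<Union>i. F i) + ennreal \<epsilon> * emeasure Q (\<Union>i. F i)"
      by (simp flip: suminf_add add: ennreal_suminf_cmult)
  qed
qed (use A in \<open>auto simp: positive_def\<close>)

lemma contaminate_in_prob_algebra:
  assumes "P \<in> space (prob_algebra borel)" "Q \<in> space (prob_algebra borel)" "0 \<le> \<epsilon>" "\<epsilon> \<le> 1"
  shows "contaminate \<epsilon> P Q \<in> space (prob_algebra borel)"
proof -
  have *: "sets P = sets borel" "sets Q = sets borel" "prob_space P" "prob_space Q"
    using assms by (auto simp: space_prob_algebra)
  then have "emeasure P UNIV = 1" "emeasure Q UNIV = 1"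
    using prob_space.emeasure_space_1 sets_eq_imp_space_eq space_borel by metis+
  then have "emeasure (contaminate \<epsilon> P Q) UNIV = 1"
    using * assms by (simp add: emeasure_contaminate flip: ennreal_plus)
  then show ?thesis
    by (auto simp: space_prob_algebra intro: prob_spaceI)
qed

text \<open>
  The supremum over contaminations ranges over those \<open>Q\<close> for which the depth median of the
  contaminated law exists; if maximizers always exist, these are all Borel laws.
\<close>

definition max_bias ::
  "'a::real_inner measure \<Rightarrow> real \<Rightarrow> ('a measure \<Rightarrow> 'a) \<Rightarrow> 'a measure \<Rightarrow> real \<Rightarrow> ennreal" where
  "max_bias \<nu> u \<theta> P \<epsilon> =
     (SUP Q \<in> {Q \<in> space (prob_algebra borel). \<exists>t. is_depth_median \<nu> u (contaminate \<epsilon> P Q) t}.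
      SUP v \<in> directions \<nu> u (contaminate \<epsilon> P Q).
        ennreal \<bar>inner (\<theta> (contaminate \<epsilon> P Q) - \<theta> P) v\<bar>)"

definition breakdown_point ::
  "'a::real_inner measure \<Rightarrow> real \<Rightarrow> ('a measure \<Rightarrow> 'a) \<Rightarrow> 'a measure \<Rightarrow> real" where
  "breakdown_point \<nu> u \<theta> P = Inf {\<epsilon> \<in> {0..1}. max_bias \<nu> u \<theta> P \<epsilon> = \<infinity>}"

definition proj_cdf :: "'a::real_inner measure \<Rightarrow> 'a \<Rightarrow> real \<Rightarrow> real" where
  "proj_cdf P v = cdf (distr P borel (\<lambda>x. inner x v))"

definition cdf_modulus :: "'a::real_inner measure \<Rightarrow> 'a \<Rightarrow> real \<Rightarrow> real" where
  "cdf_modulus P v \<delta> = Sup {\<bar>proj_cdf P v t1 - proj_cdf P v t2\<bar> | t1 t2. \<bar>t1 - t2\<bar> \<le> \<delta>}"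

definition modulus_condition ::
  "'a::real_inner measure \<Rightarrow> real \<Rightarrow> 'a measure \<Rightarrow> real \<Rightarrow> bool" where
  "modulus_condition \<nu> u P \<epsilon> \<longleftrightarrow>
     (\<exists>\<gamma>>0. measure \<nu> {v \<in> sphere 0 1. cdf_modulus P v \<gamma> < (1/2 - \<epsilon>) / (1 - \<epsilon>)} \<ge> 1 - u)"

end

theory Submission
  imports Defs
begin

text \<open>
  A small MAD of the contaminated law along \<open>v\<close> forces a thin strip orthogonal to \<open>v\<close> to carry
  mass at least \<open>(1/2 - \<epsilon>) / (1 - \<epsilon>)\<close> under the uncontaminated law. As that law has no atoms
  and \<open>\<nu>\<close> does not charge hyperplanes through the origin, Fubini's theorem shows that this
  happens only on a set of directions of \<open>\<nu>\<close>-measure below \<open>u\<close>. So the quantile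
  \<open>\<beta>\<close>, and with it the MAD along the selected directions, is at least some \<open>\<delta> > 0\<close> for every
  contamination. A ball of radius \<open>R\<close> carrying the majority of every contaminated law bounds its
  medians by \<open>R\<close> and its MADs by \<open>2R\<close>, so the origin has depth at least \<open>1 / (1 + R/\<delta>)\<close>; a
  maximizer is at least as deep and hence stays bounded along the selected directions.
  Conversely, a point mass at \<open>z\<close> of weight above one half makes every MAD vanish, so that \<open>z\<close> is
  the only point of positive depth, and \<open>z\<close> is arbitrary.
\<close>

section \<open>Medians\<close>

text \<open>This is the lower end of the median set. The upper end is
  \<open>- lower_med M (\<lambda>x. - U x)\<close>, so facts about it follow by reflection.\<close>

definition lower_med :: "'b measure \<Rightarrow> ('b \<Rightarrow> real) \<Rightarrow> real" where
  "lower_med M U = Inf {m. \<P>(x in M. U x \<le> m) \<ge> 1/2}"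

context prob_space
begin

text \<open>Right continuity of the distribution function puts the infimum into the set defining it,
  and monotonicity makes that set upward closed.\<close>

lemma lower_med_le_iff:
  assumes U[measurable]: "U \<in> borel_measurable M"
  shows "lower_med M U \<le> t \<longleftrightarrow> \<P>(x in M. U x \<le> t) \<ge> 1/2"
proof -
  interpret D: real_distribution "distr M borel U"
    by (simp add: real_distribution_distr)
  define F where "F = cdf (distr M borel U)"
  have F: "\<P>(x in M. U x \<le> m) = F m" for m
    by (simp add: F_def cdf_def measure_distr vimage_def Int_def conj_commute)
  define S where "S = {m. F m \<ge> 1/2}"
  have "eventually (\<lambda>m. F m > 1/2) at_top"
    using order_tendstoD(1)[OF D.cdf_lim_at_top_prob, of "1/2"] by (simp add: F_def)
  then have "S \<noteq> {}"
    by (force simp: S_def eventually_at_top_linorder intro: less_imp_le)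
  have "eventually (\<lambda>m. F m < 1/2) at_bot"
    using order_tendstoD(2)[OF D.cdf_lim_at_bot, of "1/2"] by (simp add: F_def)
  then obtain b where b: "\<And>m. m \<le> b \<Longrightarrow> F m < 1/2"
    by (auto simp: eventually_at_bot_linorder)
  have bdd: "bdd_below S"
    by (rule bdd_belowI[of _ b]) (metis S_def b linorder_not_less mem_Collect_eq nle_le)
  have up: "s \<in> S \<Longrightarrow> s \<le> t \<Longrightarrow> t \<in> S" for s t
    using D.cdf_nondecreasing[of s t] by (auto simp: S_def F_def)
  have "Inf S \<in> S"
  proof -
    have "(F \<longlongrightarrow> F (Inf S)) (at_right (Inf S))"
      using D.cdf_is_right_cont[of "Inf S"] by (simp add: continuous_within F_def)
    moreover have "eventually (\<lambda>m. F m \<ge> 1/2) (at_right (Inf S))"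
      unfolding eventually_at_right_field
    proof (intro exI[of _ "Inf S + 1"] conjI allI impI)
      fix y assume "Inf S < y" "y < Inf S + 1"
      then obtain s where "s \<in> S" "s < y"
        using \<open>S \<noteq> {}\<close> bdd cInf_less_iff by blast
      then show "1/2 \<le> F y"
        using up[of s y] by (simp add: S_def)
    qed simp
    ultimately have "1/2 \<le> F (Inf S)"
      by (metis tendsto_lowerbound trivial_limit_at_right_real)
    then show ?thesis by (simp add: S_def)
  qed
  then have "Inf S \<le> t \<longleftrightarrow> t \<in> S"
    using up cInf_lower[OF _ bdd] by blast
  then show ?thesis
    by (simp add: lower_med_def F S_def)
qed

text \<open>Reflecting \<open>U\<close> turns the condition on \<open>U x \<ge> m\<close> into one
  on a lower median. The interval is nonempty because any \<open>m\<close> below its lower end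
  leaves more than half of the mass above \<open>m\<close>.\<close>

lemma median_set_eq:
  assumes U[measurable]: "U \<in> borel_measurable M"
  shows "lower_med M U \<le> - lower_med M (\<lambda>x. - U x)"
    and "{m. min (\<P>(x in M. U x \<le> m)) (\<P>(x in M. U x \<ge> m)) \<ge> 1/2} =
      {lower_med M U .. - lower_med M (\<lambda>x. - U x)}"
proof -
  have upper: "m \<le> - lower_med M (\<lambda>x. - U x) \<longleftrightarrow> \<P>(x in M. U x \<ge> m) \<ge> 1/2" for m
    using lower_med_le_iff[of "\<lambda>x. - U x" "- m"] by (simp add: le_minus_iff)
  show "lower_med M U \<le> - lower_med M (\<lambda>x. - U x)"
  proof (rule dense_le)
    fix m assume "m < lower_med M U"
    then have "\<P>(x in M. U x \<le> m) < 1/2"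
      using lower_med_le_iff[OF U, of m] by linarith
    moreover have "\<P>(x in M. U x > m) = 1 - \<P>(x in M. U x \<le> m)"
      using prob_neg[of "\<lambda>x. U x \<le> m"] by (simp add: not_le)
    moreover have "\<P>(x in M. U x > m) \<le> \<P>(x in M. U x \<ge> m)"
      by (rule finite_measure_mono) auto
    ultimately show "m \<le> - lower_med M (\<lambda>x. - U x)"
      unfolding upper by linarith
  qed
  show "{m. min (\<P>(x in M. U x \<le> m)) (\<P>(x in M. U x \<ge> m)) \<ge> 1/2} =
      {lower_med M U .. - lower_med M (\<lambda>x. - U x)}"
    using upper lower_med_le_iff[OF U] by auto
qed

lemma med_eq:
  assumes "U \<in> borel_measurable M"
  shows "med M U = (lower_med M U - lower_med M (\<lambda>x. - U x)) / 2"
  using median_set_eq[OF assms] by (simp add: med_def)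

lemma prob_med_ge_half:
  assumes "U \<in> borel_measurable M"
  shows "\<P>(x in M. U x \<le> med M U) \<ge> 1/2" and "\<P>(x in M. U x \<ge> med M U) \<ge> 1/2"
proof -
  have "med M U \<in> {lower_med M U .. - lower_med M (\<lambda>x. - U x)}"
    using median_set_eq(1)[OF assms] by (simp add: med_eq[OF assms])
  then show "\<P>(x in M. U x \<le> med M U) \<ge> 1/2" "\<P>(x in M. U x \<ge> med M U) \<ge> 1/2"
    unfolding median_set_eq(2)[OF assms, symmetric] by auto
qed

lemma prob_MAD_ge_half:
  assumes [measurable]: "U \<in> borel_measurable M"
  shows "\<P>(x in M. \<bar>U x - med M U\<bar> \<le> MAD M U) \<ge> 1/2"
  unfolding MAD_def by (rule prob_med_ge_half) measurable

text \<open>An event of probability above one half meets every event of probability at least one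
  half. Hence \<open>U\<close> takes values within \<open>R\<close> of \<open>a\<close> on both
  sides of its median.\<close>

lemma med_bound:
  assumes [measurable]: "U \<in> borel_measurable M"
    and *: "\<P>(x in M. \<bar>U x - a\<bar> \<le> R) > 1/2"
  shows "\<bar>med M U - a\<bar> \<le> R"
proof -
  have disj: "\<exists>x\<in>space M. \<bar>U x - a\<bar> \<le> R \<and> Q x"
    if [measurable]: "Measurable.pred M Q" and Q: "\<P>(x in M. Q x) \<ge> 1/2" for Q
  proof (rule ccontr)
    assume "\<not> ?thesis"
    then have "\<P>(x in M. \<bar>U x - a\<bar> \<le> R) + \<P>(x in M. Q x)
        = prob ({x\<in>space M. \<bar>U x - a\<bar> \<le> R} \<union> {x\<in>space M. Q x})"
      by (intro finite_measure_Union[symmetric]) auto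
    then show False
      using * Q prob_le_1[of "{x\<in>space M. \<bar>U x - a\<bar> \<le> R} \<union> {x\<in>space M. Q x}"] by linarith
  qed
  show ?thesis
    using disj[OF _ prob_med_ge_half(1)[of U]] disj[OF _ prob_med_ge_half(2)[of U]] by force
qed

text \<open>On the majority event both \<open>U x\<close> and the median are within \<open>R\<close>
  of \<open>a\<close>, so the absolute deviation is at most \<open>2 * R\<close> there, and
  \<open>med_bound\<close> around 0 applies to it.\<close>

lemma MAD_bound:
  assumes [measurable]: "U \<in> borel_measurable M"
    and *: "\<P>(x in M. \<bar>U x - a\<bar> \<le> R) > 1/2"
  shows "\<bar>MAD M U\<bar> \<le> 2 * R"
proof -
  have "\<P>(x in M. \<bar>U x - a\<bar> \<le> R) \<le> \<P>(x in M. \<bar>\<bar>U x - med M U\<bar> - 0\<bar> \<le> 2 * R)"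
    using med_bound[OF assms] by (intro finite_measure_mono) auto
  then show ?thesis
    unfolding MAD_def using med_bound[of "\<lambda>x. \<bar>U x - med M U\<bar>" 0 "2 * R"] * by simp
qed

text \<open>By \<open>lower_med_le_iff\<close>, a sublevel set in \<open>v\<close> is a condition on
  the probability of a section of a jointly measurable set.\<close>

lemma borel_measurable_lower_med:
  assumes U[measurable]: "(\<lambda>(v, x). U v x) \<in> borel_measurable (N \<Otimes>\<^sub>M M)"
  shows "(\<lambda>v. lower_med M (U v)) \<in> borel_measurable N"
proof (rule borel_measurableI_le)
  fix t
  have "{v\<in>space N. lower_med M (U v) \<le> t} = {v\<in>space N. \<P>(x in M. U v x \<le> t) \<ge> 1/2}"
    by (intro Collect_cong conj_cong refl lower_med_le_iff) measurable
  also have "\<dots> \<in> sets N"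
    by measurable
  finally show "{v\<in>space N. lower_med M (U v) \<le> t} \<in> sets N" .
qed

lemma borel_measurable_med:
  assumes U[measurable]: "(\<lambda>(v, x). U v x) \<in> borel_measurable (N \<Otimes>\<^sub>M M)"
  shows "(\<lambda>v. med M (U v)) \<in> borel_measurable N"
proof -
  have [measurable]: "(\<lambda>v. lower_med M (U v)) \<in> borel_measurable N"
    "(\<lambda>v. lower_med M (\<lambda>x. - U v x)) \<in> borel_measurable N"
    by (rule borel_measurable_lower_med; measurable)+
  have "med M (U v) = (lower_med M (U v) - lower_med M (\<lambda>x. - U v x)) / 2" if "v \<in> space N" for v
    using that by (intro med_eq) measurable
  then show ?thesis
    by (simp cong: measurable_cong del: eq_divide_eq_numeral1)
qed

lemma borel_measurable_MAD:
  assumes U[measurable]: "(\<lambda>(v, x). U v x) \<in> borel_measurable (N \<Otimes>\<^sub>M M)"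
  shows "(\<lambda>v. MAD M (U v)) \<in> borel_measurable N"
proof -
  have [measurable]: "(\<lambda>v. med M (U v)) \<in> borel_measurable N"
    by (rule borel_measurable_med) measurable
  show ?thesis
    unfolding MAD_def by (rule borel_measurable_med) measurable
qed

end


section \<open>Concentration of projections\<close>

lemma prob_algebra_borelD:
  assumes "P \<in> space (prob_algebra borel)"
  shows "prob_space P" "sets P = sets borel" "space P = UNIV"
  using assms sets_eq_imp_space_eq[of P borel] by (auto simp: space_prob_algebra)

text \<open>Each section of the diagonal is a single point, hence null; Fubini makes the diagonal
  null.\<close>

lemma AE_pair_neq:
  fixes P :: "'a::{second_countable_topology, t2_space} measure"
  assumes P: "P \<in> space (prob_algebra borel)"
    and no_atoms: "\<And>x. measure P {x} = 0"
  shows "AE p in P \<Otimes>\<^sub>M P. fst p \<noteq> snd p"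
proof -
  interpret P: prob_space P by (rule prob_algebra_borelD[OF P])
  interpret PP: pair_sigma_finite P P ..
  note [measurable_cong] = prob_algebra_borelD(2)[OF P]
  have "AE y in P. x \<noteq> y" for x
  proof (rule AE_I)
    show "emeasure P {x} = 0"
      by (simp add: P.emeasure_eq_measure no_atoms)
  qed (use P in \<open>auto dest: prob_algebra_borelD\<close>)
  then show ?thesis
    by (intro PP.AE_pair_measure) auto
qed

lemma closed_sphere_0: "closed (sphere (0 :: 'a::real_normed_vector) r)"
  unfolding sphere_def by (intro closed_Collect_eq continuous_intros)

text \<open>Rescaling \<open>w\<close> gives the unit normal that \<open>hyperplane\<close> asks
  for. \<open>smooth\<close> speaks only of the part on the sphere, but the sphere carries all of
  \<nu>.\<close>

lemma null_kernel_direction: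
  fixes \<nu> :: "'a::{real_inner, polish_space} measure"
  assumes nu: "\<nu> \<in> space (prob_algebra borel)"
    and sphere: "measure \<nu> (sphere 0 1) = 1"
    and smooth: "\<And>H. hyperplane H \<Longrightarrow> 0 \<in> H \<Longrightarrow> measure \<nu> (H \<inter> sphere 0 1) = 0"
    and "w \<noteq> 0"
  shows "AE v in \<nu>. inner w v \<noteq> 0"
proof -
  interpret N: prob_space \<nu> by (rule prob_algebra_borelD[OF nu])
  note [measurable_cong] = prob_algebra_borelD(2)[OF nu]
  note [simp] = prob_algebra_borelD(2,3)[OF nu]
  define H where "H = {x. inner x (w /\<^sub>R norm w) = 0}"
  have H: "H = {v. inner w v = 0}"
    using \<open>w \<noteq> 0\<close> by (auto simp: H_def inner_commute)
  have "hyperplane H"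
    unfolding hyperplane_def H_def using \<open>w \<noteq> 0\<close> by (intro bexI[of _ "w /\<^sub>R norm w"] exI[of _ 0]) auto
  then have null: "measure \<nu> (H \<inter> sphere 0 1) = 0"
    by (rule smooth) (simp add: H)
  have "AE v in \<nu>. v \<notin> H \<inter> sphere 0 1"
  proof (rule AE_I)
    show "emeasure \<nu> (H \<inter> sphere 0 1) = 0"
      using null by (simp add: N.emeasure_eq_measure)
    have "closed (H \<inter> sphere 0 1)"
      unfolding H by (intro closed_Int closed_Collect_eq closed_sphere_0 continuous_intros)
    then show "H \<inter> sphere 0 1 \<in> sets \<nu>"
      by simp
  qed auto
  moreover have "AE v in \<nu>. v \<in> sphere 0 1"
    using sphere by (subst N.AE_in_set_eq_1) (auto intro: borel_closed closed_sphere_0)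
  ultimately show ?thesis
    by eventually_elim (auto simp: H)
qed

text \<open>
  Projections along almost every direction are continuous, uniformly off a set of directions of
  small measure. A strip of width \<open>2\<gamma>\<close> of mass \<open>c\<close> makes two independent copies of the law
  \<open>2\<gamma>\<close>-close along \<open>v\<close> with probability at least \<open>c\<^sup>2\<close>; averaging that probability over \<open>v\<close>
  gives, as \<open>\<gamma> \<rightarrow> 0\<close>, the probability that the difference of the copies is orthogonal to \<open>v\<close>,
  which vanishes.
\<close>

lemma strip_concentration_small:
  fixes P \<nu> :: "'a::{real_inner, polish_space} measure"
  assumes P: "P \<in> space (prob_algebra borel)"
    and no_atoms: "\<And>x. measure P {x} = 0"
    and nu: "\<nu> \<in> space (prob_algebra borel)"
    and sphere: "measure \<nu> (sphere 0 1) = 1"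
    and smooth: "\<And>H. hyperplane H \<Longrightarrow> 0 \<in> H \<Longrightarrow> measure \<nu> (H \<inter> sphere 0 1) = 0"
    and "0 < c" "0 < \<eta>"
  obtains \<gamma> where "\<gamma> > 0"
    "\<And>B. B \<in> sets borel \<Longrightarrow> (\<And>v. v \<in> B \<Longrightarrow> \<exists>m. \<P>(x in P. \<bar>inner x v - m\<bar> \<le> \<gamma>) \<ge> c)
      \<Longrightarrow> measure \<nu> B < \<eta>"
proof -
  interpret P: prob_space P by (rule prob_algebra_borelD[OF P])
  interpret N: prob_space \<nu> by (rule prob_algebra_borelD[OF nu])
  interpret PP: pair_prob_space P P ..
  interpret T: pair_prob_space "P \<Otimes>\<^sub>M P" \<nu> ..
  note [measurable_cong] = prob_algebra_borelD(2)[OF P] prob_algebra_borelD(2)[OF nu]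
  note [simp] = prob_algebra_borelD(2,3)[OF P] prob_algebra_borelD(2,3)[OF nu]
  let ?T = "(P \<Otimes>\<^sub>M P) \<Otimes>\<^sub>M \<nu>"
  \<comment> \<open>Here x and y are independent copies with law \<open>P\<close> and v is an
    independent direction; \<open>S r\<close> is the event that the copies are r-close along
    v.\<close>
  define S :: "real \<Rightarrow> (('a \<times> 'a) \<times> 'a) set" where "S r = {((x, y), v). \<bar>inner (x - y) v\<bar> \<le> r}" for r
  have S[measurable]: "S r \<in> sets ?T" for r
  proof -
    have "S r = {p \<in> space ?T. \<bar>inner (fst (fst p) - snd (fst p)) (snd p)\<bar> \<le> r}"
      by (auto simp: S_def space_pair_measure)
    also have "\<dots> \<in> sets ?T"
      by measurable
    finally show ?thesis .
  qed
  \<comment> \<open>Distinct copies have a nonzero difference, to which almost no direction is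
    orthogonal; so the limiting event \<open>S 0\<close> is null.\<close>
  have "AE p in P \<Otimes>\<^sub>M P. AE v in \<nu>. inner (fst p - snd p) v \<noteq> 0"
    using AE_pair_neq[OF P no_atoms]
    by eventually_elim (rule null_kernel_direction[OF nu sphere smooth], auto)
  moreover have "{p \<in> space ?T. inner (fst (fst p) - snd (fst p)) (snd p) \<noteq> 0} \<in> sets ?T"
    by measurable
  ultimately have "AE p in ?T. inner (fst (fst p) - snd (fst p)) (snd p) \<noteq> 0"
    by (intro T.AE_pair_measure) simp_all
  then have "AE p in ?T. p \<notin> S 0"
    by eventually_elim (auto simp: S_def)
  then have S0: "T.prob (S 0) = 0"
    using T.prob_eq_0[OF S] by blast
  have "S r \<subseteq> S r'" if "r \<le> r'" for r r'
    using that by (auto simp: S_def)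
  then have dec: "decseq (\<lambda>n. S (2 / Suc n))"
    by (simp add: decseq_def frac_le)
  \<comment> \<open>Continuity from above. The numerator 2 anticipates strips of half-width \<gamma>
    = 1 / (n + 1), whose points differ by at most 2\<gamma> along v.\<close>
  have "(\<lambda>n. T.prob (S (2 / Suc n))) \<longlonglongrightarrow> T.prob (\<Inter>n. S (2 / Suc n))"
    using S by (intro T.finite_Lim_measure_decseq dec) blast
  also have "(\<Inter>n. S (2 / Suc n)) = S 0"
  proof -
    have "a \<le> 0" if "\<And>n. a \<le> 2 / real (Suc n)" for a
    proof (rule LIMSEQ_le_const)
      show "(\<lambda>n. 2 / real (Suc n)) \<longlonglongrightarrow> 0"
        using LIMSEQ_Suc[OF lim_const_over_n[of 2]] by simp
    qed (use that in auto)
    then show ?thesis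
      by (fastforce simp: S_def intro: order_trans[of _ 0])
  qed
  finally have "eventually (\<lambda>n. T.prob (S (2 / Suc n)) < c\<^sup>2 * \<eta>) sequentially"
    using mult_pos_pos[OF zero_less_power[OF \<open>0 < c\<close>] \<open>0 < \<eta>\<close>]
    by (intro order_tendstoD(2)) (simp_all only: S0)
  then obtain n where n: "T.prob (S (2 / Suc n)) < c\<^sup>2 * \<eta>"
    by (auto simp: eventually_sequentially)
  define \<gamma> where "\<gamma> = 1 / real (Suc n)"
  have "\<gamma> > 0" by (simp add: \<gamma>_def)
  have S\<gamma>: "T.prob (S (2 * \<gamma>)) < c\<^sup>2 * \<eta>"
    using n by (simp add: \<gamma>_def)
  show ?thesis
  proof (rule that[OF \<open>\<gamma> > 0\<close>])
    fix B :: "'a set"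
    assume [measurable]: "B \<in> sets borel"
      and B: "\<And>v. v \<in> B \<Longrightarrow> \<exists>m. \<P>(x in P. \<bar>inner x v - m\<bar> \<le> \<gamma>) \<ge> c"
    \<comment> \<open>For v in \<open>B\<close>, two points of the same strip are 2\<gamma>-close
      along v, so the slice contains \<open>A \<times> A\<close>, of mass at least
      \<open>c\<^sup>2\<close>.\<close>
    have slice: "ennreal (c\<^sup>2) * indicator B v \<le> emeasure (P \<Otimes>\<^sub>M P) ((\<lambda>p. (p, v)) -` S (2 * \<gamma>))"
      (is "_ \<le> emeasure _ ?S") for v
    proof (cases "v \<in> B")
      case True
      then obtain m where m: "\<P>(x in P. \<bar>inner x v - m\<bar> \<le> \<gamma>) \<ge> c"
        using B by blast
      define A where "A = {x. \<bar>inner x v - m\<bar> \<le> \<gamma>}"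
      have [measurable]: "A \<in> sets borel"
        by (simp add: A_def)
      have "ennreal (c\<^sup>2) \<le> ennreal (P.prob A * P.prob A)"
        using m \<open>0 < c\<close> by (intro ennreal_leI) (auto simp: power2_eq_square A_def intro: mult_mono)
      also have "\<dots> = emeasure (P \<Otimes>\<^sub>M P) (A \<times> A)"
        by (simp add: P.emeasure_pair_measure_Times P.emeasure_eq_measure ennreal_mult)
      also have "\<dots> \<le> emeasure (P \<Otimes>\<^sub>M P) ?S"
        by (intro emeasure_mono sets_Pair2[OF S]) (auto simp: A_def S_def inner_diff_left)
      finally show ?thesis using True by simp
    qed simp
    \<comment> \<open>Integrating the slice bound over v, as in Markov's inequality, turns the bound
      on the joint probability into one on the measure of \<open>B\<close>.\<close>
    have "ennreal (c\<^sup>2 * measure \<nu> B) = (\<integral>\<^sup>+v. ennreal (c\<^sup>2) * indicator B v \<partial>\<nu>)"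
      by (simp add: nn_integral_cmult_indicator N.emeasure_eq_measure ennreal_mult)
    also have "\<dots> \<le> (\<integral>\<^sup>+v. emeasure (P \<Otimes>\<^sub>M P) ((\<lambda>p. (p, v)) -` S (2 * \<gamma>)) \<partial>\<nu>)"
      by (intro nn_integral_mono slice)
    also have "\<dots> = ennreal (T.prob (S (2 * \<gamma>)))"
      by (simp only: T.emeasure_pair_measure_alt2[OF S, symmetric] T.emeasure_eq_measure)
    finally have "c\<^sup>2 * measure \<nu> B \<le> T.prob (S (2 * \<gamma>))"
      by simp
    with S\<gamma> have "c\<^sup>2 * measure \<nu> B < c\<^sup>2 * \<eta>"
      by linarith
    then show "measure \<nu> B < \<eta>"
      using \<open>0 < c\<close> by simp
  qed
qed

section \<open>Contaminated laws\<close>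

lemma measure_contaminate:
  assumes "P \<in> space (prob_algebra borel)" "Q \<in> space (prob_algebra borel)"
    and "0 \<le> \<epsilon>" "\<epsilon> \<le> 1" and A: "A \<in> sets borel"
  shows "measure (contaminate \<epsilon> P Q) A = (1 - \<epsilon>) * measure P A + \<epsilon> * measure Q A"
proof -
  interpret P: prob_space P by (rule prob_algebra_borelD) fact
  interpret Q: prob_space Q by (rule prob_algebra_borelD) fact
  have "emeasure (contaminate \<epsilon> P Q) A = ennreal ((1 - \<epsilon>) * measure P A + \<epsilon> * measure Q A)"
    using assms by (simp add: emeasure_contaminate prob_algebra_borelD P.emeasure_eq_measure
        Q.emeasure_eq_measure flip: ennreal_mult ennreal_plus)
  then show ?thesis
    using assms by (intro measure_eq_emeasure_eq_ennreal) auto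
qed

lemma measurable_MAD_inner:
  fixes P :: "'a::{real_inner, polish_space} measure"
  assumes P: "P \<in> space (prob_algebra borel)"
  shows "(\<lambda>v. MAD P (\<lambda>y. inner y v)) \<in> borel_measurable borel"
proof -
  interpret P: prob_space P by (rule prob_algebra_borelD[OF P])
  note [measurable_cong] = prob_algebra_borelD(2)[OF P]
  show ?thesis by (rule P.borel_measurable_MAD) measurable
qed

text \<open>The point \<open>x0\<close> keeps the set under the infimum nonempty, so that a lower
  bound on its elements passes to \<open>Inf\<close>.\<close>

lemma le_quantileI:
  assumes "x0 \<ge> 0" "\<P>(y in M. Z y \<le> x0) \<ge> u"
    and "\<And>x. x < \<delta> \<Longrightarrow> \<P>(y in M. Z y \<le> x) < u"
  shows "\<delta> \<le> quantile u M Z"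
  unfolding quantile_def using assms by (intro cInf_greatest) (auto simp: not_le[symmetric])

lemma has_bounded_majority:
  fixes P :: "'a::real_inner measure"
  assumes P: "P \<in> space (prob_algebra borel)" and "c < 1"
  obtains R where "R > 0" "measure P (cball 0 R) > c"
proof -
  interpret P: prob_space P by (rule prob_algebra_borelD[OF P])
  have "(\<lambda>n. P.prob (cball 0 (real n))) \<longlonglongrightarrow> P.prob (\<Union>n. cball 0 (real n))"
    by (rule P.finite_Lim_measure_incseq)
      (auto simp: incseq_def prob_algebra_borelD[OF P] intro: order_trans)
  also have "(\<Union>n. cball 0 (real n)) = space P"
    by (auto simp: prob_algebra_borelD[OF P] real_arch_simple)
  finally have "eventually (\<lambda>n. P.prob (cball 0 (real n)) > c) sequentially"
    using \<open>c < 1\<close> by (intro order_tendstoD) (simp_all add: P.prob_space)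
  then have "eventually (\<lambda>n. n > 0 \<and> P.prob (cball 0 (real n)) > c) sequentially"
    using eventually_gt_at_top[of 0] by eventually_elim auto
  then obtain n where "n > 0 \<and> P.prob (cball 0 (real n)) > c"
    by (auto simp: eventually_sequentially)
  then show ?thesis
    using that[of "real n"] by simp
qed

text \<open>By Cauchy-Schwarz, projecting onto a unit vector is 1-Lipschitz, so the ball lands in an
  interval of radius \<open>R\<close>. The case \<open>R = 0\<close> serves later for a majority
  atom.\<close>

lemma projection_med_MAD_bound:
  fixes P :: "'a::{real_inner, polish_space} measure"
  assumes P: "P \<in> space (prob_algebra borel)" and half: "measure P (cball z R) > 1/2"
    and v: "norm v = 1"
  shows "\<bar>med P (\<lambda>y. inner y v) - inner z v\<bar> \<le> R" "\<bar>MAD P (\<lambda>y. inner y v)\<bar> \<le> 2 * R"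
proof -
  interpret P: prob_space P by (rule prob_algebra_borelD[OF P])
  note [measurable_cong] = prob_algebra_borelD(2)[OF P]
  note [simp] = prob_algebra_borelD(2,3)[OF P]
  have "\<bar>inner y v - inner z v\<bar> \<le> R" if "y \<in> cball z R" for y
    using Cauchy_Schwarz_ineq2[of "y - z" v] that v
    by (simp add: inner_diff_left dist_norm norm_minus_commute)
  then have "measure P (cball z R) \<le> \<P>(y in P. \<bar>inner y v - inner z v\<bar> \<le> R)"
    by (intro P.finite_measure_mono) auto
  then have "\<P>(y in P. \<bar>inner y v - inner z v\<bar> \<le> R) > 1/2"
    using half by simp
  then show "\<bar>med P (\<lambda>y. inner y v) - inner z v\<bar> \<le> R" "\<bar>MAD P (\<lambda>y. inner y v)\<bar> \<le> 2 * R"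
    by (intro P.med_bound P.MAD_bound; simp)+
qed

text \<open>The half-width \<gamma> is fixed before \<open>Q\<close>. Directions with MAD below
  \<gamma> have measure below \<open>u\<close>, so the \<open>u\<close>-quantile cannot be less than
  \<gamma>.\<close>

lemma beta_contaminate_bounded_below:
  fixes P \<nu> :: "'a::{real_inner, polish_space} measure"
  assumes P: "P \<in> space (prob_algebra borel)"
    and no_atoms: "\<And>x. measure P {x} = 0"
    and nu: "\<nu> \<in> space (prob_algebra borel)"
    and sphere: "measure \<nu> (sphere 0 1) = 1"
    and smooth: "\<And>H. hyperplane H \<Longrightarrow> 0 \<in> H \<Longrightarrow> measure \<nu> (H \<inter> sphere 0 1) = 0"
    and u: "0 < u" "u \<le> 1" and \<epsilon>: "0 \<le> \<epsilon>" "\<epsilon> < 1/2"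
  obtains \<delta> where "\<delta> > 0"
    "\<And>Q. Q \<in> space (prob_algebra borel) \<Longrightarrow> \<delta> \<le> beta \<nu> u (contaminate \<epsilon> P Q)"
proof -
  interpret P: prob_space P by (rule prob_algebra_borelD[OF P])
  interpret N: prob_space \<nu> by (rule prob_algebra_borelD[OF nu])
  note [measurable_cong] = prob_algebra_borelD(2)[OF P] prob_algebra_borelD(2)[OF nu]
  note [simp] = prob_algebra_borelD(2,3)[OF P] prob_algebra_borelD(2,3)[OF nu]
  \<comment> \<open>\<open>Q\<close> supplies at most \<epsilon> of a mass of one half, so the mass
    p under \<open>P\<close> satisfies (1 - \<epsilon>) p + \<epsilon> \<ge> 1/2, that is, p \<ge>
    c.\<close>
  define c where "c = (1/2 - \<epsilon>) / (1 - \<epsilon>)"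
  have "c > 0" using \<epsilon> by (simp add: c_def)
  obtain \<gamma> where "\<gamma> > 0" and \<gamma>: "\<And>B. B \<in> sets borel \<Longrightarrow>
      (\<And>v. v \<in> B \<Longrightarrow> \<exists>m. \<P>(x in P. \<bar>inner x v - m\<bar> \<le> \<gamma>) \<ge> c) \<Longrightarrow> measure \<nu> B < u"
    by (rule strip_concentration_small[OF P no_atoms nu sphere smooth \<open>c > 0\<close> \<open>0 < u\<close>]) blast+
  show ?thesis
  proof (rule that[OF \<open>\<gamma> > 0\<close>])
    fix Q :: "'a measure"
    assume Q: "Q \<in> space (prob_algebra borel)"
    let ?C = "contaminate \<epsilon> P Q"
    let ?M = "\<lambda>v. MAD ?C (\<lambda>y. inner y v)"
    have C: "?C \<in> space (prob_algebra borel)"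
      using contaminate_in_prob_algebra[OF P Q] \<epsilon> by simp
    interpret Q: prob_space Q by (rule prob_algebra_borelD[OF Q])
    interpret C: prob_space ?C by (rule prob_algebra_borelD[OF C])
    note [measurable] = measurable_MAD_inner[OF C]
    \<comment> \<open>This \<open>R\<close> may depend on \<open>Q\<close>: it only shows that the
      set defining the quantile is nonempty.\<close>
    obtain R where "R > 0" and R: "measure ?C (cball 0 R) > 1/2"
      using has_bounded_majority[OF C, of "1/2"] by auto
    have "?M v \<le> 2 * R" if "v \<in> sphere 0 1" for v
      using projection_med_MAD_bound(2)[OF C R, of v] that by simp
    then have "measure \<nu> (sphere 0 1) \<le> \<P>(v in \<nu>. ?M v \<le> 2 * R)"
      by (intro N.finite_measure_mono) auto
    then have upper: "u \<le> \<P>(v in \<nu>. ?M v \<le> 2 * R)"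
      using u sphere by linarith
    have "\<P>(v in \<nu>. ?M v \<le> x) < u" if "x < \<gamma>" for x
    proof (rule \<gamma>)
      fix v assume "v \<in> {v \<in> space \<nu>. ?M v \<le> x}"
      then have v: "?M v < \<gamma>" using that by simp
      let ?A = "{y. \<bar>inner y v - med ?C (\<lambda>y. inner y v)\<bar> \<le> \<gamma>}"
      have "1/2 \<le> \<P>(y in ?C. \<bar>inner y v - med ?C (\<lambda>y. inner y v)\<bar> \<le> ?M v)"
        by (intro C.prob_MAD_ge_half borel_measurable_inner)
          (simp_all add: measurable_def)
      also have "\<dots> \<le> measure ?C ?A"
        using v by (intro C.finite_measure_mono) auto
      also have "\<dots> = (1 - \<epsilon>) * measure P ?A + \<epsilon> * measure Q ?A"
        using \<epsilon> by (intro measure_contaminate P Q) auto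
      also have "\<dots> \<le> (1 - \<epsilon>) * measure P ?A + \<epsilon>"
        using \<epsilon> by (simp add: mult_left_le)
      finally have "c \<le> measure P ?A"
        using \<epsilon> by (simp add: c_def field_simps)
      then show "\<exists>m. \<P>(x in P. \<bar>inner x v - m\<bar> \<le> \<gamma>) \<ge> c"
        by auto
    qed simp
    then show "\<gamma> \<le> beta \<nu> u ?C"
      unfolding beta_def using \<open>R > 0\<close> upper by (intro le_quantileI[of "2 * R"]) auto
  qed
qed

section \<open>Breakdown\<close>

text \<open>Both \<delta> and \<open>R\<close> are chosen before \<open>Q\<close>, which makes the
  final bound uniform over contaminations.\<close>

lemma max_bias_finite:
  fixes P \<nu> :: "'a::{real_inner, polish_space} measure"
  assumes P: "P \<in> space (prob_algebra borel)"
    and no_atoms: "\<And>x. measure P {x} = 0"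
    and nu: "\<nu> \<in> space (prob_algebra borel)"
    and sphere: "measure \<nu> (sphere 0 1) = 1"
    and smooth: "\<And>H. hyperplane H \<Longrightarrow> 0 \<in> H \<Longrightarrow> measure \<nu> (H \<inter> sphere 0 1) = 0"
    and u: "0 < u" "u \<le> 1"
    and theta: "depth_median_choice \<nu> u \<theta>"
    and \<epsilon>: "0 \<le> \<epsilon>" "\<epsilon> < 1/2"
  shows "max_bias \<nu> u \<theta> P \<epsilon> < \<infinity>"
proof -
  obtain \<delta> where "\<delta> > 0"
    and \<delta>: "\<And>Q. Q \<in> space (prob_algebra borel) \<Longrightarrow> \<delta> \<le> beta \<nu> u (contaminate \<epsilon> P Q)"
    by (rule beta_contaminate_bounded_below[OF P no_atoms nu sphere smooth u \<epsilon>]) blast+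
  \<comment> \<open>With this threshold the part (1 - \<epsilon>) \<open>P\<close> alone gives the
    ball more than half of the mass, whatever \<open>Q\<close> is.\<close>
  have "(1/2) / (1 - \<epsilon>) < 1" using \<epsilon> by simp
  then obtain R where "R > 0" and R: "measure P (cball 0 R) > (1/2) / (1 - \<epsilon>)"
    using has_bounded_majority[OF P] by metis
  \<comment> \<open>\<open>K\<close> will bound the outlyingness of the origin: medians are at most
    \<open>R\<close> in absolute value and MADs at least \<delta>.\<close>
  define K where "K = R / \<delta>"
  have "K > 0" using \<open>R > 0\<close> \<open>\<delta> > 0\<close> by (simp add: K_def)
  have bound: "\<bar>inner (\<theta> (contaminate \<epsilon> P Q) - \<theta> P) v\<bar> \<le> K * (2 * R) + R + norm (\<theta> P)"
    if Q: "Q \<in> space (prob_algebra borel)" and ex: "\<exists>t. is_depth_median \<nu> u (contaminate \<epsilon> P Q) t"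
      and v: "v \<in> directions \<nu> u (contaminate \<epsilon> P Q)" for Q v
  proof -
    let ?C = "contaminate \<epsilon> P Q"
    let ?t = "\<theta> ?C"
    let ?med = "\<lambda>v. med ?C (\<lambda>y. inner y v)" and ?MAD = "\<lambda>v. MAD ?C (\<lambda>y. inner y v)"
    have C: "?C \<in> space (prob_algebra borel)"
      using contaminate_in_prob_algebra[OF P Q] \<epsilon> by simp
    have "1/2 < (1 - \<epsilon>) * measure P (cball 0 R)"
      using R \<epsilon> by (simp add: field_simps)
    also have "\<dots> \<le> measure ?C (cball 0 R)"
      using \<epsilon> by (simp add: measure_contaminate[OF P Q])
    finally have half: "measure ?C (cball 0 R) > 1/2" .
    have dir: "\<bar>?med w\<bar> \<le> R" "\<delta> \<le> ?MAD w" "?MAD w \<le> 2 * R" "norm w = 1"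
      if "w \<in> directions \<nu> u ?C" for w
      using that \<delta>[OF Q] projection_med_MAD_bound[OF C half, of w]
      by (auto simp: directions_def)
    \<comment> \<open>MADs bounded away from 0 reduce the extended outlyingness to a real
      quotient.\<close>
    have outl: "inverse (1 + outlyingness ?C w x) = ennreal (inverse (1 + \<bar>inner x w - ?med w\<bar> / ?MAD w))"
      if "w \<in> directions \<nu> u ?C" for w x
    proof -
      have "outlyingness ?C w x = ennreal (\<bar>inner x w - ?med w\<bar> / ?MAD w)"
        using dir(2)[OF that] \<open>\<delta> > 0\<close> by (simp add: outlyingness_def divide_ennreal)
      then show ?thesis
        using dir(2)[OF that] \<open>\<delta> > 0\<close>
        by (simp add: inverse_ennreal add_pos_nonneg flip: ennreal_1 ennreal_plus)
    qed
    have "ennreal (inverse (1 + K)) \<le> depth \<nu> u ?C 0"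
      unfolding depth_def
    proof (rule INF_greatest)
      fix w assume w: "w \<in> directions \<nu> u ?C"
      have "\<bar>inner 0 w - ?med w\<bar> / ?MAD w \<le> K"
        unfolding K_def using dir[OF w] \<open>\<delta> > 0\<close> \<open>R > 0\<close> by (intro frac_le) auto
      moreover have "0 \<le> \<bar>inner 0 w - ?med w\<bar> / ?MAD w"
        using dir(2)[OF w] \<open>\<delta> > 0\<close> by simp
      ultimately show "ennreal (inverse (1 + K)) \<le> inverse (1 + outlyingness ?C w 0)"
        unfolding outl[OF w] by (intro ennreal_leI le_imp_inverse_le) auto
    qed
    \<comment> \<open>The origin lies in every span, so the maximizer must be at least as
      deep.\<close>
    also have "\<dots> \<le> depth \<nu> u ?C ?t"
    proof -
      have "is_depth_median \<nu> u ?C ?t"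
        using theta C ex by (simp add: depth_median_choice_def)
      moreover have "0 \<in> closure (span (directions \<nu> u ?C))"
        using closure_subset span_zero by blast
      ultimately show ?thesis
        by (auto simp: is_depth_median_def is_arg_max_def not_less)
    qed
    also have "\<dots> \<le> inverse (1 + outlyingness ?C v ?t)"
      unfolding depth_def by (rule INF_lower[OF v])
    also have "\<dots> = ennreal (inverse (1 + \<bar>inner ?t v - ?med v\<bar> / ?MAD v))"
      by (rule outl[OF v])
    finally have "inverse (1 + K) \<le> inverse (1 + \<bar>inner ?t v - ?med v\<bar> / ?MAD v)"
      using dir(2)[OF v] \<open>\<delta> > 0\<close> \<open>K > 0\<close> by (subst (asm) ennreal_le_iff) auto
    then have "\<bar>inner ?t v - ?med v\<bar> / ?MAD v \<le> K"
      using \<open>K > 0\<close> dir(2)[OF v] \<open>\<delta> > 0\<close> by (simp add: inverse_le_iff_le add_pos_nonneg)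
    then have "\<bar>inner ?t v - ?med v\<bar> \<le> K * ?MAD v"
      using dir(2)[OF v] \<open>\<delta> > 0\<close> by (simp add: pos_divide_le_eq)
    also have "\<dots> \<le> K * (2 * R)"
      using dir(3)[OF v] \<open>K > 0\<close> by (intro mult_left_mono) auto
    finally have "\<bar>inner ?t v\<bar> \<le> K * (2 * R) + R"
      using dir(1)[OF v] by linarith
    moreover have "\<bar>inner (\<theta> P) v\<bar> \<le> norm (\<theta> P)"
      using Cauchy_Schwarz_ineq2[of "\<theta> P" v] dir(4)[OF v] by simp
    ultimately show ?thesis
      by (simp add: inner_diff_left)
  qed
  have "max_bias \<nu> u \<theta> P \<epsilon> \<le> ennreal (K * (2 * R) + R + norm (\<theta> P))"
    unfolding max_bias_def by (intro SUP_least ennreal_leI bound) auto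
  also have "\<dots> < \<infinity>" by simp
  finally show ?thesis .
qed

text \<open>Every projection has its median at the projection of \<open>z\<close> and MAD 0, so the
  quantile is at most 0 and all directions are selected. The conventions 0 / 0 = 0 and a / 0 =
  \<infinity> then give \<open>z\<close> depth 1 and every other point depth 0.\<close>

lemma
  fixes P \<nu> :: "'a::{real_inner, polish_space} measure"
  assumes P: "P \<in> space (prob_algebra borel)" and atom: "measure P {z} > 1/2"
    and nu: "\<nu> \<in> space (prob_algebra borel)" and u: "u \<le> 1"
    and sphere: "measure \<nu> (sphere 0 1) = 1"
  shows directions_majority_atom: "directions \<nu> u P = sphere 0 1"
    and depth_median_majority_atom: "is_depth_median \<nu> u P t \<longleftrightarrow> t = z"
proof -
  interpret N: prob_space \<nu> by (rule prob_algebra_borelD[OF nu])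
  note [measurable_cong] = prob_algebra_borelD(2)[OF nu]
  note [simp] = prob_algebra_borelD(2,3)[OF nu]
  note [measurable] = measurable_MAD_inner[OF P]
  have "measure P (cball z 0) > 1/2"
    using atom by simp
  then have med: "med P (\<lambda>y. inner y v) = inner z v" and MAD: "MAD P (\<lambda>y. inner y v) = 0"
    if "v \<in> sphere 0 1" for v
    using projection_med_MAD_bound[OF P, of z 0 v] that by simp_all
  have "measure \<nu> (sphere 0 1) \<le> \<P>(v in \<nu>. MAD P (\<lambda>y. inner y v) \<le> 0)"
    using MAD by (intro N.finite_measure_mono) auto
  then have "u \<le> \<P>(v in \<nu>. MAD P (\<lambda>y. inner y v) \<le> 0)"
    using u sphere by linarith
  then have "beta \<nu> u P \<le> 0"
    unfolding beta_def quantile_def by (intro cInf_lower bdd_belowI[of _ 0]) auto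
  then show dir: "directions \<nu> u P = sphere 0 1"
    using MAD by (auto simp: directions_def)
  have span: "span (sphere 0 1) = (UNIV :: 'a set)"
  proof (intro set_eqI iffI UNIV_I)
    fix x :: 'a
    show "x \<in> span (sphere 0 1)"
    proof (cases "x = 0")
      case False
      then have "norm x *\<^sub>R (x /\<^sub>R norm x) \<in> span (sphere 0 1)"
        by (intro span_scale span_base) auto
      then show ?thesis using False by simp
    qed (simp add: span_zero)
  qed
  \<comment> \<open>Over an empty set of directions the infimum would be \<infinity> instead of
    1.\<close>
  have "sphere 0 1 \<noteq> ({} :: 'a set)"
    using sphere by force
  then have depth_z: "depth \<nu> u P z = 1"
    by (simp add: depth_def dir outlyingness_def med MAD)
  have depth_other: "depth \<nu> u P x = 0" if "x \<noteq> z" for x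
  proof -
    \<comment> \<open>Along the direction from \<open>z\<close> to \<open>x\<close> the projections
      differ by the full distance.\<close>
    let ?v = "(x - z) /\<^sub>R norm (x - z)"
    have v: "?v \<in> sphere 0 1" using that by simp
    have "inner x ?v - inner z ?v = inner (x - z) (x - z) / norm (x - z)"
      unfolding inner_scaleR_right by (simp add: inner_diff_left divide_inverse algebra_simps)
    also have "\<dots> = norm (x - z)"
      by (simp add: dot_square_norm power2_eq_square)
    finally have "inner x ?v - inner z ?v = norm (x - z)" .
    then have "outlyingness P ?v x = \<infinity>"
      using that med[OF v] MAD[OF v] by (simp add: outlyingness_def ennreal_divide_eq_top_iff)
    moreover have "depth \<nu> u P x \<le> inverse (1 + outlyingness P ?v x)"
      unfolding depth_def dir by (rule INF_lower[OF v])
    ultimately show ?thesis by simp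
  qed
  have "depth \<nu> u P x \<le> 1" for x
    using depth_z depth_other by (cases "x = z") auto
  then show "is_depth_median \<nu> u P t \<longleftrightarrow> t = z"
    unfolding is_depth_median_def is_arg_max_def dir span
    by (metis UNIV_I closure_UNIV depth_other depth_z linorder_not_less zero_less_one)
qed

lemma max_bias_infinite:
  fixes P \<nu> :: "'a::{real_inner, polish_space} measure"
  assumes P: "P \<in> space (prob_algebra borel)" and nu: "\<nu> \<in> space (prob_algebra borel)"
    and sphere: "measure \<nu> (sphere 0 1) = 1" and u: "u \<le> 1"
    and theta: "depth_median_choice \<nu> u \<theta>"
    and \<epsilon>: "1/2 < \<epsilon>" "\<epsilon> \<le> 1"
  shows "max_bias \<nu> u \<theta> P \<epsilon> = \<infinity>"
proof -
  obtain e :: 'a where e: "norm e = 1"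
    using sphere by (metis equals0I measure_empty mem_sphere_0 zero_neq_one)
  have "ennreal (real n) \<le> max_bias \<nu> u \<theta> P \<epsilon>" for n
  proof -
    \<comment> \<open>A majority atom at \<open>z\<close> forces the depth median to be
      \<open>z\<close>, so shifting by \<open>n\<close> along the unit vector \<open>e\<close>
      yields bias exactly \<open>n\<close> in a selected direction.\<close>
    define z where "z = \<theta> P + real n *\<^sub>R e"
    let ?Q = "return borel z"
    let ?C = "contaminate \<epsilon> P ?Q"
    have Q: "?Q \<in> space (prob_algebra borel)"
      by (simp add: space_prob_algebra prob_space_return)
    have C: "?C \<in> space (prob_algebra borel)"
      using contaminate_in_prob_algebra[OF P Q] \<epsilon> by simp
    have "measure ?C {z} = (1 - \<epsilon>) * measure P {z} + \<epsilon>"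
      using \<epsilon> by (simp add: measure_contaminate[OF P Q] measure_return)
    moreover have "0 \<le> (1 - \<epsilon>) * measure P {z}"
      using \<epsilon> by simp
    ultimately have "measure ?C {z} > 1/2"
      using \<epsilon> by linarith
    note C_facts = directions_majority_atom[OF C this nu u sphere]
      depth_median_majority_atom[OF C this nu u sphere]
    have "\<theta> ?C = z"
      using theta C C_facts(2) by (auto simp: depth_median_choice_def)
    then have "real n = \<bar>inner (\<theta> ?C - \<theta> P) e\<bar>"
      using e by (simp add: z_def flip: power2_norm_eq_inner)
    then show ?thesis
      unfolding max_bias_def
      by (intro SUP_upper2[of ?Q] SUP_upper2[of e]) (use Q C_facts e in auto)
  qed
  then show ?thesis
    by (metis ennreal_of_nat_eq_real_of_nat ennreal_SUP_of_nat_eq_top SUP_least infinity_ennreal_def top.extremum_unique)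
qed

theorem theorem5:
  fixes PX \<nu> :: "'a::{real_inner, polish_space} measure"
    and u :: real
    and \<theta> :: "'a measure \<Rightarrow> 'a"
  assumes PX: "PX \<in> space (prob_algebra borel)"
    and no_atoms: "\<And>x. measure PX {x} = 0"
    and u: "0 < u" "u < 1"
    and nu: "\<nu> \<in> space (prob_algebra borel)"
    and supp: "has_support \<nu> (sphere 0 1)"
    and smooth: "\<And>H. hyperplane H \<Longrightarrow> 0 \<in> H \<Longrightarrow> measure \<nu> (H \<inter> sphere 0 1) = 0"
    and theta: "depth_median_choice \<nu> u \<theta>"
  shows "(\<forall>\<epsilon>\<in>{0<..<1/2}. modulus_condition \<nu> u PX \<epsilon> \<longrightarrow> max_bias \<nu> u \<theta> PX \<epsilon> < \<infinity>) \<and>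
         ((\<forall>\<epsilon>\<in>{0<..<1/2}. modulus_condition \<nu> u PX \<epsilon>) \<longrightarrow> breakdown_point \<nu> u \<theta> PX = 1/2)"
proof -
  have sphere: "measure \<nu> (sphere 0 1) = 1"
    using supp by (simp add: has_support_def)
  \<comment> \<open>The infimum in \<open>breakdown_point\<close> ranges over [0, 1], so level 0
    must be covered too.\<close>
  have finite: "max_bias \<nu> u \<theta> PX \<epsilon> < \<infinity>" if "0 \<le> \<epsilon>" "\<epsilon> < 1/2" for \<epsilon>
    using max_bias_finite[OF PX no_atoms nu sphere smooth _ _ theta] u that by simp
  have infinite: "max_bias \<nu> u \<theta> PX \<epsilon> = \<infinity>" if "1/2 < \<epsilon>" "\<epsilon> \<le> 1" for \<epsilon>
    using max_bias_infinite[OF PX nu sphere _ theta] u that by simp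
  have "breakdown_point \<nu> u \<theta> PX = 1/2"
    unfolding breakdown_point_def
  \<comment> \<open>Finite bias below 1/2 and infinite bias above it determine the infimum; level
    1/2 itself is left undecided.\<close>
  proof (rule cInf_eq_non_empty)
    show "{\<epsilon> \<in> {0..1}. max_bias \<nu> u \<theta> PX \<epsilon> = \<infinity>} \<noteq> {}"
      using infinite[of 1] by force
    show "1/2 \<le> \<epsilon>" if "\<epsilon> \<in> {\<epsilon> \<in> {0..1}. max_bias \<nu> u \<theta> PX \<epsilon> = \<infinity>}" for \<epsilon>
      using that finite[of \<epsilon>] by (force simp: not_le[symmetric])
    show "y \<le> 1/2" if y: "\<And>\<epsilon>. \<epsilon> \<in> {\<epsilon> \<in> {0..1}. max_bias \<nu> u \<theta> PX \<epsilon> = \<infinity>} \<Longrightarrow> y \<le> \<epsilon>" for y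
    proof (rule dense_ge_bounded[of "1/2" 1])
      show "y \<le> \<epsilon>" if "1/2 < \<epsilon>" "\<epsilon> < 1" for \<epsilon>
        using y[of \<epsilon>] infinite[of \<epsilon>] that by simp
    qed simp
  qed
  then show ?thesis
    using finite by auto
qed

end
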